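(* Let $A\in\mathbb{R}^{m\times n}$ be such that $|\rho_A^-|>0$, and let $W=\{p\in\triangle : Ap=\mathbf{0}\}$. Then for every $p\in\triangle$, $$\mathrm{dist}_1(p,W)\le\frac{2\|Ap\|}{\|Ap\|+|\rho_A^-|}\le\frac{2\|Ap\|}{|\rho_A^-|}=\frac{2\|p\|_G}{|\rho_A^-|},$$ where $\mathrm{dist}_1(p,W)=\inf_{q\in W}\|p-q\|_1$ is the distance from $p$ to $W$ in the $\ell_1$ norm.
   Context: $\mathrm{lin}(A)=\{A\alpha:\alpha\in\mathbb{R}^n\}\subseteq\mathbb{R}^m$ is the linear span of the columns of $A$; $\triangle=\{p\in\mathbb{R}^n: p\ge\mathbf{0},\ \|p\|_1=1\}$ is the probability simplex; $\|\cdot\|$ is the Euclidean norm; $G=A^TA$ and $\|\alpha\|_G=\sqrt{\alpha^TG\alpha}=\|A\alpha\|$. The affine-margin of $A$ is $\rho_A:=\sup\{\inf_{p\in\triangle}w^TAp : w\in\mathrm{lin}(A),\ \|w\|=1\}$, and $\rho_A^-:=\min\{0,\rho_A\}$. (In the degenerate case $A=0$ the supremum is over the empty set and equals $-\infty$, and division by $\infty$ gives $0$.) *)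

theory Defs
  imports "HOL-Analysis.Analysis"
begin

definition lin :: "real^'n^'m \<Rightarrow> (real^'m) set" where
  "lin A = range (\<lambda>\<alpha>. A *v \<alpha>)"

definition l1_norm :: "real^'n \<Rightarrow> real" where
  "l1_norm x = (\<Sum>i\<in>UNIV. \<bar>x $ i\<bar>)"

definition prob_simplex :: "(real^'n) set" where
  "prob_simplex = {p. (\<forall>i. 0 \<le> p $ i) \<and> l1_norm p = 1}"

definition gram :: "real^'n^'m \<Rightarrow> real^'n^'n" where
  "gram A = transpose A ** A"

definition gram_norm :: "real^'n^'m \<Rightarrow> real^'n \<Rightarrow> real" where
  "gram_norm A \<alpha> = sqrt (\<alpha> \<bullet> (gram A *v \<alpha>))"

(* Valued in the extended reals: for A = 0 no unit vector lies in lin A, and the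
   supremum of the empty set is then -\<infinity>. *)
definition affine_margin :: "real^'n^'m \<Rightarrow> ereal" where
  "affine_margin A =
     (SUP w\<in>{w \<in> lin A. norm w = 1}. INF p\<in>prob_simplex. ereal (w \<bullet> (A *v p)))"

definition neg_affine_margin :: "real^'n^'m \<Rightarrow> ereal" where
  "neg_affine_margin A = min 0 (affine_margin A)"

(* Valued in the extended reals, so that the distance to the empty set is \<infinity>
   rather than an unspecified real number. *)
definition dist1 :: "real^'n \<Rightarrow> (real^'n) set \<Rightarrow> ereal" where
  "dist1 p W = (INF q\<in>W. ereal (l1_norm (p - q)))"

end

theory Submission
  imports Defs
begin

text \<open>
  Let \<open>r = \<bar>\<rho>\<^sub>A\<^sup>-\<bar>\<close>. Separating a point from its nearest point in the compact convex set
  \<open>A \<triangle>\<close> shows that \<open>A \<triangle>\<close> contains every vector of \<open>lin A\<close> of norm at most \<open>r\<close>. Hence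
  \<open>- r Ap / \<parallel>Ap\<parallel> = Aq'\<close> for some \<open>q' \<in> \<triangle>\<close>, and moving from \<open>p\<close> towards \<open>q'\<close> by the
  fraction \<open>\<parallel>Ap\<parallel> / (\<parallel>Ap\<parallel> + r)\<close> reaches the kernel of \<open>A\<close>.
\<close>

lemma prob_simplex_alt:
  "prob_simplex = {p :: real^'n. (\<forall>i. 0 \<le> p $ i) \<and> (\<Sum>i\<in>UNIV. p $ i) = 1}"
  by (auto simp: prob_simplex_def l1_norm_def)

lemma convex_prob_simplex: "convex (prob_simplex :: (real^'n) set)"
  unfolding prob_simplex_alt convex_def
  by (auto simp: sum.distrib simp flip: sum_distrib_left)

lemma compact_prob_simplex: "compact (prob_simplex :: (real^'n) set)"
proof -
  have "norm p \<le> 1" if "p \<in> prob_simplex" for p :: "real^'n"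
    using norm_le_l1_cart[of p] that unfolding prob_simplex_def l1_norm_def by auto
  then have "bounded (prob_simplex :: (real^'n) set)"
    by (auto simp: bounded_iff)
  moreover have "closed (prob_simplex :: (real^'n) set)"
    unfolding prob_simplex_alt
    by (intro closed_Collect_conj closed_Collect_all closed_Collect_le closed_Collect_eq
        continuous_intros)
  ultimately show ?thesis
    by (simp add: compact_eq_bounded_closed)
qed

lemma l1_norm_scaleR: "l1_norm (c *\<^sub>R x) = \<bar>c\<bar> * l1_norm x"
  by (simp add: l1_norm_def abs_mult sum_distrib_left)

lemma l1_norm_diff_le: "l1_norm (x - y) \<le> l1_norm x + l1_norm y"
  unfolding l1_norm_def sum.distrib[symmetric]
  by (intro sum_mono) (simp add: abs_triangle_ineq4)

lemma gram_norm_eq: "gram_norm A \<alpha> = norm (A *v \<alpha>)"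
  by (simp add: gram_norm_def gram_def norm_eq_sqrt_inner dot_lmul_matrix
      flip: matrix_vector_mul_assoc)
    (metis dot_lmul_matrix inner_commute transpose_matrix_vector)

lemma subspace_lin: "subspace (lin A)"
  unfolding lin_def
  by (intro linear_subspace_image subspace_UNIV matrix_vector_mul_linear)

text \<open>Compactness of the simplex turns the extended-real infimum into a real number attained
  at a point, so that real inequalities apply to it.\<close>

lemma margin_attained:
  fixes A :: "real^'n^'m"
  assumes "(prob_simplex :: (real^'n) set) \<noteq> {}"
  obtains k where "k \<in> prob_simplex"
    "(INF p\<in>prob_simplex. ereal (w \<bullet> (A *v p))) = ereal (w \<bullet> (A *v k))"
proof -
  have "continuous_on prob_simplex (\<lambda>p. w \<bullet> (A *v p))"
    by (intro continuous_intros linear_continuous_on matrix_vector_mul_linear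
        matrix_vector_mul_bounded_linear)
  then obtain k where k: "k \<in> prob_simplex"
    "\<And>p. p \<in> prob_simplex \<Longrightarrow> w \<bullet> (A *v k) \<le> w \<bullet> (A *v p)"
    using continuous_attains_inf[OF compact_prob_simplex assms] by metis
  have "(INF p\<in>prob_simplex. ereal (w \<bullet> (A *v p))) = ereal (w \<bullet> (A *v k))"
    by (rule antisym) (auto intro!: INF_lower INF_greatest k)
  with k(1) show ?thesis
    by (rule that)
qed

text \<open>If \<open>v\<close> lay outside, the unit vector \<open>u\<close> pointing from
  \<open>v\<close> to its nearest point would give \<open>u \<bullet> v\<close> a value strictly
  below the minimum of \<open>u\<close> over the image of the simplex. That minimum is at most
  \<open>- r\<close>, while \<open>norm v \<le> r\<close> forces
  \<open>u \<bullet> v \<ge> - r\<close>.\<close>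

lemma margin_ball_subset:
  fixes A :: "real^'n^'m"
  assumes margin: "affine_margin A \<le> ereal (- r)"
    and ne: "(prob_simplex :: (real^'n) set) \<noteq> {}"
    and v: "v \<in> lin A" "norm v \<le> r"
  shows "v \<in> (*v) A ` prob_simplex"
proof (rule ccontr)
  let ?K = "(*v) A ` (prob_simplex :: (real^'n) set)"
  assume "v \<notin> ?K"
  have "convex ?K"
    by (intro convex_linear_image convex_prob_simplex matrix_vector_mul_linear)
  have "closed ?K"
    by (intro compact_imp_closed compact_continuous_image compact_prob_simplex
        linear_continuous_on matrix_vector_mul_bounded_linear)
  define k0 where "k0 = closest_point ?K v"
  define w where "w = k0 - v"
  have "k0 \<in> ?K"
    unfolding k0_def using \<open>closed ?K\<close> ne by (intro closest_point_in_set) auto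
  \<comment> \<open>Since \<open>v\<close> also lies in \<open>lin A\<close>, the direction
    \<open>u\<close> will be admissible in the supremum that defines the margin.\<close>
  then have "k0 \<in> lin A"
    by (auto simp: lin_def)
  have "w \<noteq> 0"
    using \<open>k0 \<in> ?K\<close> \<open>v \<notin> ?K\<close> by (auto simp: w_def)
  define u where "u = w /\<^sub>R norm w"
  have "u \<in> lin A" "norm u = 1"
    using subspace_lin[of A] v(1) \<open>k0 \<in> lin A\<close> \<open>w \<noteq> 0\<close>
    by (auto simp: u_def w_def subspace_diff subspace_scale)
  obtain k where k: "k \<in> prob_simplex"
    "(INF p\<in>prob_simplex. ereal (u \<bullet> (A *v p))) = ereal (u \<bullet> (A *v k))"
    using margin_attained[OF ne] .
  have "ereal (u \<bullet> (A *v k)) \<le> affine_margin A"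
    unfolding affine_margin_def k(2)[symmetric]
    by (rule SUP_upper) (use \<open>u \<in> lin A\<close> \<open>norm u = 1\<close> in auto)
  with margin have "ereal (u \<bullet> (A *v k)) \<le> ereal (- r)"
    by (rule order_trans[rotated])
  then have le: "u \<bullet> (A *v k) \<le> - r"
    by simp
  \<comment> \<open>Obtuse angle at the nearest point of a closed convex set, applied to the
    minimiser \<open>k\<close>.\<close>
  have "(v - k0) \<bullet> (A *v k - k0) \<le> 0"
    unfolding k0_def using \<open>convex ?K\<close> \<open>closed ?K\<close> k(1)
    by (intro closest_point_dot) auto
  then have "w \<bullet> v + w \<bullet> w \<le> w \<bullet> (A *v k)"
    by (simp add: w_def inner_diff_left inner_diff_right inner_commute)
  moreover have "w \<bullet> w > 0"
    using \<open>w \<noteq> 0\<close> by simp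
  ultimately have "w \<bullet> v < w \<bullet> (A *v k)"
    by linarith
  then have "u \<bullet> v < u \<bullet> (A *v k)"
    using \<open>w \<noteq> 0\<close> by (simp add: u_def divide_simps)
  moreover have "- norm v \<le> u \<bullet> v"
    using Cauchy_Schwarz_ineq2[of u v] \<open>norm u = 1\<close> by simp
  ultimately show False
    using le v(2) by linarith
qed

lemma l1_close_kernel_point:
  fixes A :: "real^'n^'m"
  assumes p: "p \<in> prob_simplex" and "r > 0" and margin: "affine_margin A \<le> ereal (- r)"
  shows "\<exists>q\<in>prob_simplex. A *v q = 0 \<and>
           l1_norm (p - q) \<le> 2 * norm (A *v p) / (norm (A *v p) + r)"
proof (cases "A *v p = 0")
  case True
  with p show ?thesis
    by (intro bexI[of _ p]) (auto simp: l1_norm_def)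
next
  case False
  define n where "n = norm (A *v p)"
  have "n > 0"
    using False by (simp add: n_def)
  \<comment> \<open>Opposite in direction to \<open>A *v p\<close> and of norm exactly
    \<open>r\<close>, the largest that the ball inclusion allows.\<close>
  define v where "v = (- r / n) *\<^sub>R (A *v p)"
  have "v \<in> lin A"
    unfolding v_def by (intro subspace_scale subspace_lin) (simp add: lin_def)
  moreover have "norm v \<le> r"
    using \<open>r > 0\<close> \<open>n > 0\<close> by (simp add: v_def n_def)
  ultimately obtain q' where q': "q' \<in> prob_simplex" "A *v q' = v"
    using margin_ball_subset[OF margin] p by blast
  \<comment> \<open>The solution of \<open>1 - t = t * r / n\<close>, which makes
    \<open>A *v p\<close> and \<open>v\<close> cancel in \<open>A *v q\<close>.\<close>
  define t where "t = n / (n + r)"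
  have t: "0 \<le> t" "t \<le> 1"
    using \<open>r > 0\<close> \<open>n > 0\<close> by (auto simp: t_def)
  define q where "q = (1 - t) *\<^sub>R p + t *\<^sub>R q'"
  have "q \<in> prob_simplex"
    unfolding q_def using convex_prob_simplex p q'(1) t by (auto simp: convex_alt)
  moreover have "A *v q = 0"
  proof -
    have "A *v q = (1 - t - t * r / n) *\<^sub>R (A *v p)"
      by (simp add: q_def q'(2) v_def matrix_vector_right_distrib matrix_vector_mult_scaleR
          matrix_vector_mult_diff_distrib scaleR_left_diff_distrib)
    also have "1 - t = r / (n + r)"
      using \<open>r > 0\<close> \<open>n > 0\<close> by (simp add: t_def diff_divide_eq_iff)
    also have "r / (n + r) - t * r / n = 0"
      using \<open>n > 0\<close> by (simp add: t_def)
    finally show ?thesis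
      by simp
  qed
  moreover have "l1_norm (p - q) \<le> 2 * n / (n + r)"
  proof -
    have "p - q = t *\<^sub>R (p - q')"
      by (simp add: q_def algebra_simps)
    then have "l1_norm (p - q) = t * l1_norm (p - q')"
      using t by (simp add: l1_norm_scaleR)
    \<comment> \<open>Two points of l1 norm 1 are at l1 distance at most 2.\<close>
    also have "\<dots> \<le> t * 2"
      using l1_norm_diff_le[of p q'] p q'(1) t
      by (intro mult_left_mono) (auto simp: prob_simplex_def)
    finally show ?thesis
      by (simp add: t_def mult.commute)
  qed
  ultimately show ?thesis
    unfolding n_def by blast
qed

lemma dist1_le: "q \<in> W \<Longrightarrow> l1_norm (p - q) \<le> d \<Longrightarrow> dist1 p W \<le> ereal d"
  unfolding dist1_def by (rule INF_lower2) auto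

text \<open>Normalising \<open>A *v p\<close> gives an admissible direction, and its infimum over
  the simplex is attained, hence finite.\<close>

lemma affine_margin_not_MInf:
  fixes A :: "real^'n^'m"
  assumes "p \<in> prob_simplex" "A *v p \<noteq> 0"
  shows "affine_margin A \<noteq> - \<infinity>"
proof -
  define w where "w = (A *v p) /\<^sub>R norm (A *v p)"
  have w: "w \<in> lin A" "norm w = 1"
    using subspace_scale[OF subspace_lin[of A]] assms(2) by (auto simp: w_def lin_def)
  obtain k where k: "(INF p\<in>prob_simplex. ereal (w \<bullet> (A *v p))) = ereal (w \<bullet> (A *v k))"
    using margin_attained assms(1) by (metis empty_iff)
  have "ereal (w \<bullet> (A *v k)) \<le> affine_margin A"
    unfolding affine_margin_def k[symmetric] by (rule SUP_upper) (use w in auto)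
  then show ?thesis
    by auto
qed

theorem proposition4:
  fixes A :: "real^'n^'m" and W :: "(real^'n) set" and p :: "real^'n"
  assumes "\<bar>neg_affine_margin A\<bar> > 0"
    and "W = {q \<in> prob_simplex. A *v q = 0}"
    and "p \<in> prob_simplex"
  shows "dist1 p W \<le>
           ereal (2 * norm (A *v p)) / (ereal (norm (A *v p)) + \<bar>neg_affine_margin A\<bar>) \<and>
         ereal (2 * norm (A *v p)) / (ereal (norm (A *v p)) + \<bar>neg_affine_margin A\<bar>) \<le>
           ereal (2 * norm (A *v p)) / \<bar>neg_affine_margin A\<bar> \<and>
         ereal (2 * norm (A *v p)) / \<bar>neg_affine_margin A\<bar> =
           ereal (2 * gram_norm A p) / \<bar>neg_affine_margin A\<bar>"
proof (cases "\<bar>neg_affine_margin A\<bar>")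
  \<comment> \<open>Degenerate case: \<open>A *v p = 0\<close>, so \<open>p\<close> itself lies in
    \<open>W\<close> and all quotients are 0.\<close>
  case PInf
  then have "affine_margin A = - \<infinity>"
    by (auto simp: neg_affine_margin_def min_def split: if_splits)
      (cases "affine_margin A"; simp)
  then have "A *v p = 0"
    using affine_margin_not_MInf assms(3) by blast
  then have "dist1 p W \<le> ereal 0"
    using assms by (intro dist1_le[of p]) (auto simp: l1_norm_def)
  with \<open>A *v p = 0\<close> PInf show ?thesis
    by (simp add: gram_norm_eq zero_ereal_def)
next
  case (real r)
  then have "r > 0"
    using assms(1) by simp
  \<comment> \<open>As \<open>r > 0\<close>, the minimum with 0 is the margin itself.\<close>
  with real have "affine_margin A = ereal (- r)"
    by (cases "affine_margin A") (auto simp: neg_affine_margin_def min_def split: if_splits)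
  then obtain q where "q \<in> W"
    "l1_norm (p - q) \<le> 2 * norm (A *v p) / (norm (A *v p) + r)"
    using l1_close_kernel_point[OF assms(3) \<open>r > 0\<close>, of A] assms(2) by auto
  then have "dist1 p W \<le> ereal (2 * norm (A *v p) / (norm (A *v p) + r))"
    by (rule dist1_le)
  moreover have "2 * norm (A *v p) / (norm (A *v p) + r) \<le> 2 * norm (A *v p) / r"
    using \<open>r > 0\<close> by (intro divide_left_mono mult_pos_pos add_nonneg_pos) auto
  \<comment> \<open>With nonzero denominators, the extended-real quotients reduce to real
    ones.\<close>
  moreover have "norm (A *v p) + r \<noteq> 0"
    using \<open>r > 0\<close> norm_ge_zero[of "A *v p"] by linarith
  ultimately show ?thesis
    using \<open>r > 0\<close> by (simp add: real gram_norm_eq)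
next
  case MInf
  with assms(1) show ?thesis
    by simp
qed

end
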